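(* Let $n\ge1$ be an integer, let $L>0$, let $f:\mathbb{R}^d\to\mathbb{R}$ be convex and $L$-smooth, and let $x_\star\in\arg\min f$. Let $r\in(0,1)$ be the unique solution in $(0,1)$ of $r^n(1+n(1+r))=1$, and put $h=1+r$ and $\eta=r^n=(1+nh)^{-1}$. For any $x_0\in\mathbb{R}^d$ let $x_{i+1}=x_i-\frac{h}{L}\nabla f(x_i)$, $i=0,\ldots,n-1$. Then simultaneously $$f(x_n)-f(x_\star)\le\frac{\eta L}{2(1-\eta)}\|x_0-x_\star\|^2=\frac{L}{2nh}\|x_0-x_\star\|^2,$$ $$\|\nabla f(x_n)\|^2\le\frac{\eta^2L^2}{1-\eta}\|x_0-x_\star\|^2=\frac{\eta L^2}{nh}\|x_0-x_\star\|^2,$$ $$\|x_n-x_\star\|\le\|x_0-x_\star\|.$$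
   Context: $\|\cdot\|$ is the Euclidean norm. $L$-smooth means differentiable with $L$-Lipschitz gradient. *)

theory Defs
  imports "HOL-Analysis.Analysis"
begin

(* The value is meaningful only at points where f is differentiable; there the
   vector D with derivative (\<lambda>v. v \<bullet> D) exists and is unique. *)
definition gradient :: "('a::euclidean_space \<Rightarrow> real) \<Rightarrow> 'a \<Rightarrow> 'a" where
  "gradient f x = (THE D. GDERIV f x :> D)"

definition L_smooth :: "real \<Rightarrow> ('a::euclidean_space \<Rightarrow> real) \<Rightarrow> bool" where
  "L_smooth L f \<longleftrightarrow> (\<forall>x. f differentiable (at x)) \<and> L-lipschitz_on UNIV (gradient f)"

end

theory Submission
  imports Defs
begin

text \<open>
  After dividing \<open>f\<close> by \<open>L\<close>, put \<open>g\<^sub>i = \<nabla>f(x\<^sub>i)\<close>, \<open>y\<^sub>i = x\<^sub>i - g\<^sub>i\<close> and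
  \<open>F\<^sub>i = f(x\<^sub>i) - \<parallel>g\<^sub>i\<parallel>\<^sup>2 / 2\<close>. The interpolation inequalities of smooth convex functions become the
  subgradient inequalities \<open>F\<^sub>i \<ge> F\<^sub>j + \<langle>g\<^sub>j, y\<^sub>i - y\<^sub>j\<rangle>\<close>, and a gradient step becomes
  \<open>y\<^sub>i - y\<^sub>i\<^sub>+\<^sub>1 = r g\<^sub>i + g\<^sub>i\<^sub>+\<^sub>1\<close>. All three bounds are read off from the single inequality
  \<open>\<parallel>x\<^sub>n - x\<^sub>\<star>\<parallel>\<^sup>2 + s(1 + s) \<parallel>g\<^sub>n\<parallel>\<^sup>2 + 2 s (f(x\<^sub>n) - f(x\<^sub>\<star>)) \<le> \<parallel>x\<^sub>0 - x\<^sub>\<star>\<parallel>\<^sup>2\<close> with \<open>s = n h\<close>, which is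
  an equality for the half squared norm and for Huber functions of small slope. The usual expansion of
  \<open>\<parallel>x\<^sub>n - x\<^sub>\<star>\<parallel>\<^sup>2\<close> reduces it to an inequality between the \<open>F\<^sub>j - F\<^sub>n\<close> and the \<open>\<parallel>g\<^sub>j\<parallel>\<^sup>2\<close>, and
  that inequality is a nonnegative combination of the subgradient inequalities for the pairs
  \<open>(p, q)\<close> with \<open>p < q\<close>, the pairs \<open>(k + 1, k)\<close> and the pairs \<open>(n, p)\<close>, with no square left over.
\<close>

section \<open>Explicit sums and a sign criterion for sequences\<close>

text \<open>Raising \<open>n\<close> by one adds \<open>x\<close> times a geometric sum, which one
  factor \<open>x - 1\<close> collapses. It is used at \<open>x = 1 / r\<^sup>2\<close> to evaluate
  the recursion for the multipliers at its endpoint.\<close>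

lemma sum_linear_geometric:
  fixes x :: real
  shows "(x - 1)\<^sup>2 * (\<Sum>i<n. (real n - real i) * x ^ Suc i)
    = x ^ (n + 2) - (real n + 1) * x\<^sup>2 + real n * x"
proof (induction n)
  case 0
  show ?case by (simp add: power2_eq_square)
next
  case (Suc n)
  have "(\<Sum>i<Suc n. (real (Suc n) - real i) * x ^ Suc i)
      = (\<Sum>i<n. (real n - real i) * x ^ Suc i) + x * (\<Sum>i<Suc n. x ^ i)"
    by (simp add: sum_distrib_left algebra_simps sum.distrib sum_subtractf)
  moreover have "(x - 1)\<^sup>2 * (x * (\<Sum>i<Suc n. x ^ i)) = x * (x - 1) * (x ^ Suc n - 1)"
    unfolding power_diff_1_eq by (simp only: power2_eq_square mult_ac)
  ultimately have "(x - 1)\<^sup>2 * (\<Sum>i<Suc n. (real (Suc n) - real i) * x ^ Suc i)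
      = (x - 1)\<^sup>2 * (\<Sum>i<n. (real n - real i) * x ^ Suc i) + x * (x - 1) * (x ^ Suc n - 1)"
    by (simp only: distrib_left)
  then show ?case
    unfolding Suc.IH by (simp add: algebra_simps power2_eq_square)
qed

lemma sum_linear: "(\<Sum>i<n. real n - real i) = real n * (real n + 1) / 2"
proof (induction n)
  case (Suc n)
  have "(\<Sum>i<Suc n. real (Suc n) - real i) = (\<Sum>i<n. real n - real i) + real (Suc n)"
    by (simp add: sum.distrib sum_subtractf algebra_simps)
  then show ?case unfolding Suc.IH by (simp add: field_simps)
qed simp

text \<open>Since \<open>s\<close> is antitone, the sequence rises up to some index and falls
  afterwards, so it is bounded below by one of its end values: by \<open>G 0\<close> when
  \<open>s k\<close> is nonnegative, by \<open>G n\<close> otherwise.\<close>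

lemma nonneg_if_unimodal:
  fixes G s :: "nat \<Rightarrow> real"
  assumes "G 0 \<ge> 0" "G n \<ge> 0"
    and diff: "\<And>k. k < n \<Longrightarrow> \<exists>c\<ge>0. G (Suc k) - G k = c * s k"
    and s: "antimono s" and "k \<le> n"
  shows "G k \<ge> 0"
proof (cases "s k \<ge> 0")
  case True
  have "j \<le> k \<Longrightarrow> G j \<ge> 0" for j
  proof (induction j)
    case (Suc j)
    obtain c where "c \<ge> 0" "G (Suc j) - G j = c * s j"
      using diff[of j] Suc.prems \<open>k \<le> n\<close> by auto
    moreover have "s j \<ge> 0" using antimonoD[OF s, of j k] Suc.prems True by simp
    ultimately show ?case using Suc by (metis Suc_leD add_increasing2 diff_add_cancel mult_nonneg_nonneg)
  qed (use assms in simp)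
  then show ?thesis by simp
next
  case False
  have "k \<le> j \<Longrightarrow> j \<le> n \<Longrightarrow> G k \<ge> G j" for j
  proof (induction j rule: dec_induct)
    case (step j)
    obtain c where c: "c \<ge> 0" "G (Suc j) - G j = c * s j"
      using diff[of j] step by auto
    moreover have "s j \<le> 0" using antimonoD[OF s, of k j] step False by simp
    ultimately have "G (Suc j) - G j \<le> 0" by (simp add: mult_nonneg_nonpos)
    then show ?case using step by simp
  qed simp
  from this[of n] show ?thesis using \<open>k \<le> n\<close> \<open>G n \<ge> 0\<close> by simp
qed

section \<open>Existence of the multipliers\<close>

text \<open>
  The last identity below is what makes the function values cancel in the weighted sum of
  inequalities. Differencing it turns it into a two-term recursion for
  \<open>(n - k) (n - k + 1) \<alpha> k\<close>, and the equation for \<open>r\<close> says exactly that the solution of that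
  recursion returns to \<open>0\<close> at \<open>k = n\<close>.
\<close>

lemma multipliers_exist:
  fixes r :: real
  assumes r: "0 < r" "r < 1" and n: "n \<ge> 1" and root: "r ^ n * (1 + real n * (1 + r)) = 1"
  defines "e \<equiv> \<lambda>k. ((1 / r\<^sup>2) ^ k - 1) / 2"
  shows "\<exists>\<alpha> :: nat \<Rightarrow> real. \<alpha> 0 = 0 \<and> (\<forall>k<n. \<alpha> k \<le> \<alpha> (Suc k)) \<and> (\<forall>k\<le>n. \<alpha> k \<le> e k) \<and> \<alpha> n = e n \<and>
    (\<forall>k\<le>n. (real n - real k) * \<alpha> k + (1 - r) / (1 + r) * e k = real k + (\<Sum>i<k. \<alpha> i))"
proof -
  define \<rho> where "\<rho> = 1 / r\<^sup>2"
  define \<kappa> where "\<kappa> = (1 - r) / (1 + r)"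
  \<comment> \<open>\<open>t k\<close> is \<open>1 - \<kappa> * (e (Suc k) - e k)\<close>, the
    inhomogeneity left by differencing the balance identity. Multiplied by \<open>n - k\<close>, it
    is the increment of \<open>v\<close>, which stands for
    \<open>(n - k + 1) (n - k) \<alpha> k\<close>.\<close>
  define t where "t k = 1 - (1 - r)\<^sup>2 / 2 * \<rho> ^ Suc k" for k
  define v where "v k = (\<Sum>i<k. (real n - real i) * t i)" for k
  \<comment> \<open>At \<open>k = n\<close> the recursion leaves \<open>\<alpha>\<close> free,
    because its factor there is zero; the value \<open>e n\<close> is imposed.\<close>
  define \<alpha> where "\<alpha> k = (if k = n then e n else v k / ((real n - real k + 1) * (real n - real k)))" for k
  have rho_r: "\<rho> - 1 = (1 - r) * (1 + r) * \<rho>"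
    using r by (simp add: \<rho>_def field_simps power2_eq_square)
  have rho: "\<rho> > 1" using r by (simp add: \<rho>_def power_less_one_iff abs_square_less_1)
  have e: "e k = (\<rho> ^ k - 1) / 2" for k by (simp add: e_def \<rho>_def)
  have e_mono: "e k \<le> e (Suc k)" for k
    using rho power_increasing[of k "Suc k" \<rho>] by (simp add: e)
  have rn: "\<rho> ^ n = (1 + real n * (1 + r))\<^sup>2"
  proof -
    have "(1 / r) ^ n = 1 + real n * (1 + r)"
      using root r by (simp add: field_simps)
    moreover have "\<rho> ^ n = ((1 / r) ^ n)\<^sup>2"
      by (simp add: \<rho>_def power_divide flip: power_mult) (simp add: mult.commute)
    ultimately show ?thesis by simp
  qed
  have v_n: "v n = 0"
  proof -
    have "v n = (\<Sum>i<n. (real n - real i)) - (1 - r)\<^sup>2 / 2 * (\<Sum>i<n. (real n - real i) * \<rho> ^ Suc i)"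
      unfolding v_def t_def sum_distrib_left sum_subtractf[symmetric]
      by (intro sum.cong refl) (simp only: right_diff_distrib mult_1_right mult.left_commute)
    \<comment> \<open>The equation for \<open>r\<close> enters here through \<open>rn\<close>: it
      turns \<open>\<rho> ^ n - (n + 1) + n * r\<^sup>2\<close> into
      \<open>n * (n + 1) * (1 + r)\<^sup>2\<close>.\<close>
    moreover have "(1 - r)\<^sup>2 * (\<Sum>i<n. (real n - real i) * \<rho> ^ Suc i) = real n * (real n + 1)"
    proof -
      have "(\<rho> - 1)\<^sup>2 = (1 - r)\<^sup>2 * ((1 + r)\<^sup>2 * \<rho>\<^sup>2)"
        unfolding rho_r by (simp add: power_mult_distrib)
      then have "(1 - r)\<^sup>2 * (\<Sum>i<n. (real n - real i) * \<rho> ^ Suc i) * ((1 + r)\<^sup>2 * \<rho>\<^sup>2)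
          = \<rho> ^ (n + 2) - (real n + 1) * \<rho>\<^sup>2 + real n * \<rho>"
        using sum_linear_geometric[of \<rho> n] by (simp add: algebra_simps)
      also have "\<dots> = \<rho>\<^sup>2 * (\<rho> ^ n - (real n + 1) + real n * r\<^sup>2)"
        using r by (simp add: \<rho>_def power_add field_simps power2_eq_square)
      also have "\<dots> = real n * (real n + 1) * ((1 + r)\<^sup>2 * \<rho>\<^sup>2)"
        unfolding rn by (simp add: algebra_simps power2_eq_square)
      finally show ?thesis using r rho by simp
    qed
    ultimately show ?thesis by (simp add: sum_linear)
  qed
  have v_Suc: "v (Suc k) = v k + (real n - real k) * t k" for k by (simp add: v_def)
  have v_alpha: "(real n - real k + 1) * (real n - real k) * \<alpha> k = v k" if "k \<le> n" for k
    using that v_n by (auto simp: \<alpha>_def)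
  have alpha_0: "\<alpha> 0 = 0" using n by (simp add: \<alpha>_def v_def)
  have alpha_e: "\<alpha> k \<le> e k" if "k \<le> n" for k
  proof -
    \<comment> \<open>With denominators cleared, the claim for \<open>k < n\<close> is that
      \<open>G\<close> is nonnegative. \<open>G\<close> vanishes at \<open>0\<close> and at
      \<open>n\<close>, and its increments are nonnegative multiples of a decreasing affine function
      of \<open>k\<close>.\<close>
    define G where "G k = (real n - real k + 1) * (real n - real k) * e k - v k" for k
    have "G k \<ge> 0"
    proof (rule nonneg_if_unimodal)
      show "antimono (\<lambda>k. (real n - real k) * (\<rho> - 1) - 2 / r)"
        using rho by (auto intro!: antimonoI mult_right_mono)
      show "G 0 \<ge> 0" "G n \<ge> 0" by (simp_all add: G_def v_n) (simp add: e v_def)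
      show "\<exists>c\<ge>0. G (Suc k) - G k = c * ((real n - real k) * (\<rho> - 1) - 2 / r)" if "k < n" for k
      proof (intro exI conjI)
        show "0 \<le> (real n - real k) * \<rho> ^ k / 2" using that rho by simp
        define c m z where "c = 2 / r" and "m = real n - real k" and "z = \<rho> ^ k"
        have "(1 - r)\<^sup>2 * \<rho> = \<rho> - c + 1"
          using r by (simp add: \<rho>_def c_def field_simps power2_eq_square)
        then have t: "t k = 1 - z * (\<rho> - c + 1) / 2"
          by (simp add: t_def z_def mult.assoc[symmetric])
        have m: "real n - real (Suc k) = m - 1" by (simp add: m_def)
        show "G (Suc k) - G k = (real n - real k) * \<rho> ^ k / 2 * ((real n - real k) * (\<rho> - 1) - 2 / r)"
          unfolding G_def v_Suc t e m m_def[symmetric] c_def[symmetric] power_Suc z_def[symmetric]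
          by (simp add: field_simps)
      qed
    qed (use that in simp)
    then have *: "(real n - real k + 1) * (real n - real k) * (e k - \<alpha> k) \<ge> 0"
      using v_alpha[OF that] by (simp add: G_def algebra_simps)
    show ?thesis
    proof (cases "k = n")
      case False
      then have "(real n - real k + 1) * (real n - real k) > 0" using that by simp
      then show ?thesis using * by (simp add: zero_le_mult_iff)
    qed (simp add: \<alpha>_def)
  qed
  \<comment> \<open>The last step is treated apart, since \<open>\<alpha> n\<close> does not come
    from \<open>v\<close>; there the bound by \<open>e\<close> suffices.\<close>
  have alpha_mono: "\<alpha> k \<le> \<alpha> (Suc k)" if "k < n" for k
  proof (cases "Suc k = n")
    case True
    then show ?thesis using alpha_e[of k] e_mono[of k] by (simp add: \<alpha>_def)
  next
    case False
    \<comment> \<open>\<open>w k\<close> is the increment of \<open>\<alpha>\<close> at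
      \<open>k\<close> with denominators cleared. It decreases because \<open>t\<close> does, and it
      ends at \<open>w n = 0\<close>.\<close>
    define w where "w k = (real n - real k + 1) * (real n - real k) * t k + 2 * v k" for k
    have w_dec: "w (Suc k) \<le> w k" if "k < n" for k
    proof -
      have "t (Suc k) \<le> t k"
        using rho power_increasing[of "Suc k" "Suc (Suc k)" \<rho>] unfolding t_def
        by (intro diff_mono mult_left_mono) auto
      moreover have "w (Suc k) - w k = (real n - real k) * (real n - real (Suc k)) * (t (Suc k) - t k)"
        by (simp add: w_def v_Suc algebra_simps)
      moreover have "(real n - real k) * (real n - real (Suc k)) \<ge> 0"
        using that by simp
      ultimately have "w (Suc k) - w k \<le> 0"
        by (simp only:) (intro mult_nonneg_nonpos, simp_all)
      then show ?thesis by simp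
    qed
    have "w j \<le> w k" if "k \<le> j" "j \<le> n" for j
      using that
    proof (induction j rule: dec_induct)
      case (step j)
      then show ?case using w_dec[of j] by simp
    qed simp
    from this[of n] have "w n \<le> w k" using \<open>k < n\<close> by simp
    then have "w k \<ge> 0" by (simp add: w_def v_n)
    moreover have "(real n - real k + 1) * (real n - real k) * (real n - real (Suc k)) * (\<alpha> (Suc k) - \<alpha> k) = w k"
    proof -
      define m where "m = real n - real k"
      have 1: "m * (m - 1) * \<alpha> (Suc k) = v k + m * t k"
        using v_alpha[of "Suc k"] that v_Suc[of k] by (simp add: m_def algebra_simps)
      have 2: "(m + 1) * m * \<alpha> k = v k" using v_alpha[of k] that by (simp add: m_def)
      have "(m + 1) * m * (m - 1) * (\<alpha> (Suc k) - \<alpha> k)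
         = (m + 1) * (m * (m - 1) * \<alpha> (Suc k)) - (m - 1) * ((m + 1) * m * \<alpha> k)"
        by (simp add: algebra_simps)
      also have "\<dots> = (m + 1) * m * t k + 2 * v k" unfolding 1 2 by (simp add: algebra_simps)
      finally show ?thesis by (simp add: w_def m_def algebra_simps)
    qed
    moreover have "(real n - real k + 1) * (real n - real k) * (real n - real (Suc k)) > 0"
      using False that by simp
    ultimately have "0 \<le> \<alpha> (Suc k) - \<alpha> k"
      by (metis mult_pos_neg not_less)
    then show ?thesis by simp
  qed
  have "(real n - real k) * \<alpha> k + \<kappa> * e k = real k + (\<Sum>i<k. \<alpha> i)" if "k \<le> n" for k
    using that
  proof (induction k)
    case 0
    show ?case by (simp add: alpha_0 e)
  next
    case (Suc k)
    define m where "m = real n - real k"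
    have "\<kappa> * (e (Suc k) - e k) = 1 - t k"
    proof -
      have "e (Suc k) - e k = (\<rho> - 1) * \<rho> ^ k / 2"
        by (simp add: e algebra_simps diff_divide_distrib)
      also have "\<dots> = (1 - r) * (1 + r) * \<rho> * \<rho> ^ k / 2"
        unfolding rho_r ..
      finally have "e (Suc k) - e k = (1 + r) * ((1 - r) * \<rho> ^ Suc k / 2)"
        by simp
      then show ?thesis using r by (simp only:) (simp add: \<kappa>_def t_def power2_eq_square)
    qed
    moreover have "(m - 1) * \<alpha> (Suc k) = (m + 1) * \<alpha> k + t k"
    proof -
      have m: "m > 0" using Suc.prems by (simp add: m_def)
      have "m * (m - 1) * \<alpha> (Suc k) = v k + m * t k"
        using v_alpha[OF Suc.prems] v_Suc[of k] by (simp add: m_def algebra_simps)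
      moreover have "(m + 1) * m * \<alpha> k = v k"
        using v_alpha[of k] Suc.prems by (simp add: m_def)
      ultimately have "m * ((m - 1) * \<alpha> (Suc k)) = m * ((m + 1) * \<alpha> k + t k)"
        by (simp add: distrib_left mult_ac)
      then show ?thesis using m by simp
    qed
    moreover have "m * \<alpha> k + \<kappa> * e k = real k + (\<Sum>i<k. \<alpha> i)"
      using Suc by (simp add: m_def)
    ultimately have "(m - 1) * \<alpha> (Suc k) + \<kappa> * e (Suc k) = real (Suc k) + (\<Sum>i<Suc k. \<alpha> i)"
      by (simp add: algebra_simps)
    moreover have "real n - real (Suc k) = m - 1" by (simp add: m_def)
    ultimately show ?case by (simp only:)
  qed
  then show ?thesis using alpha_0 alpha_mono alpha_e by (intro exI[of _ \<alpha>]) (auto simp: \<alpha>_def \<kappa>_def)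
qed

section \<open>Summation by parts\<close>

text \<open>Moving the base point from \<open>u q\<close> to \<open>u (Suc q)\<close> costs the
  total weight so far, which telescopes to \<open>a q\<close>. Differences to a common endpoint thus
  become consecutive differences.\<close>

lemma sum_increment_Abel:
  fixes a :: "nat \<Rightarrow> real" and u :: "nat \<Rightarrow> 'a::real_vector"
  assumes "a 0 = 0"
  shows "(\<Sum>p<q. (a (Suc p) - a p) *\<^sub>R (u p - u q)) = (\<Sum>p<q. a (Suc p) *\<^sub>R (u p - u (Suc p)))"
proof (induction q)
  case (Suc q)
  have "(\<Sum>p<q. (a (Suc p) - a p) *\<^sub>R (u p - u (Suc q)))
      = (\<Sum>p<q. (a (Suc p) - a p) *\<^sub>R (u p - u q)) + (\<Sum>p<q. (a (Suc p) - a p)) *\<^sub>R (u q - u (Suc q))"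
    by (simp add: scaleR_sum_left sum.distrib[symmetric] scaleR_right_distrib[symmetric])
  then show ?case
    unfolding Suc.IH by (simp add: sum_lessThan_telescope assms scaleR_left_diff_distrib)
qed simp

text \<open>The version with vector weights serves the pairs \<open>(n, p)\<close>, whose gradient
  varies with \<open>p\<close> and is absorbed into the weight.\<close>

lemma sum_inner_increment_Abel:
  fixes H u :: "nat \<Rightarrow> 'a::real_inner"
  assumes "H 0 = 0"
  shows "(\<Sum>p<q. (H (Suc p) - H p) \<bullet> (u p - u q)) = (\<Sum>p<q. H (Suc p) \<bullet> (u p - u (Suc p)))"
proof (induction q)
  case (Suc q)
  have "(\<Sum>p<q. (H (Suc p) - H p) \<bullet> (u p - u (Suc q)))
      = (\<Sum>p<q. (H (Suc p) - H p) \<bullet> (u p - u q)) + (\<Sum>p<q. (H (Suc p) - H p)) \<bullet> (u q - u (Suc q))"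
    by (simp add: inner_sum_left sum.distrib[symmetric] inner_right_distrib[symmetric])
  then show ?case
    unfolding Suc.IH by (simp add: sum_lessThan_telescope assms inner_diff_left)
qed simp

lemma sum_tails:
  fixes c :: "nat \<Rightarrow> real"
  shows "(\<Sum>q<n. \<Sum>p<q. c p) = (\<Sum>p<n. (real n - 1 - real p) * c p)"
  by (induction n) (simp_all add: sum.distrib[symmetric] algebra_simps)

lemma sum_gaps:
  fixes F :: "nat \<Rightarrow> real"
  shows "(\<Sum>j<n. F j - F n) = (\<Sum>p<n. (real p + 1) * (F p - F (Suc p)))"
  using sum_increment_Abel[of real F n] by (simp add: add.commute)

section \<open>The weighted combination of subgradient inequalities\<close>

text \<open>After summation by parts the combination consists of consecutive gaps of
  \<open>F\<close>, inner products with the partial sums \<open>H\<close>, and squares. These three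
  groups are matched separately by \<open>coeff\<close>, \<open>inner_cancel\<close> and
  \<open>diag\<close>.\<close>

lemma last_gradient_bound:
  fixes g y :: "nat \<Rightarrow> 'a::real_inner" and F :: "nat \<Rightarrow> real" and r :: real
  assumes r: "0 < r" "r < 1" and n: "n \<ge> 1" and root: "r ^ n * (1 + real n * (1 + r)) = 1"
    and subgrad: "\<And>i j. i \<le> n \<Longrightarrow> j \<le> n \<Longrightarrow> F j + g j \<bullet> (y i - y j) \<le> F i"
    and step: "\<And>i. i < n \<Longrightarrow> y i - y (Suc i) = r *\<^sub>R g i + g (Suc i)"
  shows "real n * (2 + real n * (1 + r)) / 2 * (norm (g n))\<^sup>2
    \<le> (\<Sum>j<n. F j - F n) + (1 - r) / 2 * (\<Sum>j<n. (norm (g j))\<^sup>2)"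
proof -
  define e where "e k = ((1 / r\<^sup>2) ^ k - 1) / 2" for k
  define h \<kappa> where "h = 1 + r" and "\<kappa> = (1 - r) / h"
  have h: "h > 1" using r by (simp add: h_def)
  \<comment> \<open>Monotonicity, the bound by \<open>e\<close> and nonnegativity give the signs of
    the forward, adjacent and backward weights respectively.\<close>
  obtain \<alpha> :: "nat \<Rightarrow> real" where alpha_0: "\<alpha> 0 = 0" and mono: "\<And>k. k < n \<Longrightarrow> \<alpha> k \<le> \<alpha> (Suc k)"
    and alpha_e: "\<And>k. k \<le> n \<Longrightarrow> \<alpha> k \<le> e k" and alpha_n: "\<alpha> n = e n"
    and balance: "\<And>k. k \<le> n \<Longrightarrow> (real n - real k) * \<alpha> k + \<kappa> * e k = real k + (\<Sum>i<k. \<alpha> i)"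
    using multipliers_exist[OF r n root] unfolding e_def \<kappa>_def h_def by metis
  have alpha_nonneg: "\<alpha> k \<ge> 0" if "k \<le> n" for k
    using that
  proof (induction k)
    case (Suc k)
    then show ?case using mono[of k] by simp
  qed (simp add: alpha_0)
  define \<Delta> where "\<Delta> p = F p - F (Suc p)" for p
  define G where "G p = g p \<bullet> g p" for p
  \<comment> \<open>The coefficient of \<open>g i\<close> is \<open>h\<close> times the weight of
    the pair \<open>(n, i)\<close>. It is what regrouping the forward sums by gradients produces,
    see \<open>H_alt\<close>.\<close>
  define H where "H q = (\<Sum>i<q. (r * \<alpha> (Suc i) + \<alpha> i) *\<^sub>R g i)" for q
  define \<eta> where "\<eta> q = (\<Sum>i<q. r * \<alpha> (Suc i) + \<alpha> i)" for q
  \<comment> \<open>The adjacent weights absorb the slack between \<open>\<alpha>\<close> and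
    \<open>e\<close>, so they vanish at \<open>0\<close> and at \<open>n\<close>.\<close>
  define \<beta> where "\<beta> k = \<kappa> * (e k - \<alpha> k)" for k
  have H_0: "H 0 = 0" and H_Suc: "H (Suc p) = H p + (r * \<alpha> (Suc p) + \<alpha> p) *\<^sub>R g p" for p
    by (simp_all add: H_def)
  have H_alt: "(\<Sum>p<q. \<alpha> (Suc p) *\<^sub>R (r *\<^sub>R g p + g (Suc p))) = H q + \<alpha> q *\<^sub>R g q" for q
    by (induction q) (simp_all add: H_0 alpha_0 H_Suc algebra_simps)

  \<comment> \<open>The weight of \<open>(p, q)\<close> is \<open>\<alpha> (p + 1) - \<alpha> p\<close>, independently of \<open>q < n\<close>; for \<open>q = n\<close> it gets an
    extra factor \<open>1 / h\<close>.\<close>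
  have forward: "g q \<bullet> H q + \<alpha> q * G q \<le> (\<Sum>p<q. \<alpha> (Suc p) * \<Delta> p)" if "q \<le> n" for q
  proof -
    have "0 \<le> (\<Sum>p<q. (\<alpha> (Suc p) - \<alpha> p) * (F p - F q - g q \<bullet> (y p - y q)))"
      using that mono subgrad by (intro sum_nonneg mult_nonneg_nonneg) (auto simp: algebra_simps)
    also have "\<dots> = (\<Sum>p<q. (\<alpha> (Suc p) - \<alpha> p) *\<^sub>R (F p - F q))
        - g q \<bullet> (\<Sum>p<q. (\<alpha> (Suc p) - \<alpha> p) *\<^sub>R (y p - y q))"
      by (simp add: inner_sum_right sum_subtractf[symmetric] right_diff_distrib)
    also have "(\<Sum>p<q. (\<alpha> (Suc p) - \<alpha> p) *\<^sub>R (y p - y q)) = H q + \<alpha> q *\<^sub>R g q"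
      unfolding sum_increment_Abel[of \<alpha>, OF alpha_0] H_alt[symmetric]
      using that by (intro sum.cong refl) (simp add: step)
    finally show ?thesis
      unfolding sum_increment_Abel[of \<alpha>, OF alpha_0]
      by (simp add: \<Delta>_def G_def inner_add_right)
  qed
  have backward: "(\<Sum>p<n. \<eta> (Suc p) * \<Delta> p) \<le> (\<Sum>p<n. H (Suc p) \<bullet> (r *\<^sub>R g p + g (Suc p)))"
  proof -
    have "(\<Sum>p<n. (\<eta> (Suc p) - \<eta> p) *\<^sub>R (F p - F n)) \<le> (\<Sum>p<n. (H (Suc p) - H p) \<bullet> (y p - y n))"
    proof (rule sum_mono)
      fix p assume "p \<in> {..<n}"
      then have "F p - F n \<le> g p \<bullet> (y p - y n)" and "r * \<alpha> (Suc p) + \<alpha> p \<ge> 0"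
        using subgrad[of n p] alpha_nonneg r by (auto simp: inner_diff_right)
      then have "(r * \<alpha> (Suc p) + \<alpha> p) * (F p - F n) \<le> (r * \<alpha> (Suc p) + \<alpha> p) * (g p \<bullet> (y p - y n))"
        by (rule mult_left_mono)
      then show "(\<eta> (Suc p) - \<eta> p) *\<^sub>R (F p - F n) \<le> (H (Suc p) - H p) \<bullet> (y p - y n)"
        by (simp add: \<eta>_def H_def)
    qed
    moreover have "\<eta> 0 = 0" by (simp add: \<eta>_def)
    ultimately show ?thesis
      using sum_increment_Abel[of \<eta> F n]
      by (simp add: sum_inner_increment_Abel H_0 \<Delta>_def step)
  qed
  \<comment> \<open>Weighting \<open>(k + 1, k)\<close> against \<open>(k, k + 1)\<close> by \<open>r : 1\<close> removes the cross term \<open>g k \<bullet> g (k + 1)\<close>.\<close>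
  have adjacent: "0 \<le> \<beta> (Suc k) * (\<Delta> k - (G (Suc k) - r\<^sup>2 * G k) / (1 - r))" if "k < n" for k
  proof -
    have "0 \<le> (\<Delta> k - g (Suc k) \<bullet> (y k - y (Suc k))) + r * (g k \<bullet> (y k - y (Suc k)) - \<Delta> k)"
      using subgrad[of k "Suc k"] subgrad[of "Suc k" k] that r
      by (intro add_nonneg_nonneg mult_nonneg_nonneg) (auto simp: \<Delta>_def inner_diff_right)
    also have "\<dots> = (1 - r) * \<Delta> k - (G (Suc k) - r\<^sup>2 * G k)"
      unfolding step[OF that]
      by (simp add: G_def inner_add_right inner_commute power2_eq_square algebra_simps)
    finally have "0 \<le> \<Delta> k - (G (Suc k) - r\<^sup>2 * G k) / (1 - r)"
      using r by (simp add: pos_divide_le_eq mult.commute)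
    moreover have "\<beta> (Suc k) \<ge> 0"
      using that alpha_e[of "Suc k"] r h by (simp add: \<beta>_def \<kappa>_def)
    ultimately show ?thesis by simp
  qed

  \<comment> \<open>Coefficient of \<open>\<Delta> p\<close>: the index \<open>p\<close> occurs in
    the forward sums of the \<open>n - 1 - p\<close> values \<open>q\<close> with
    \<open>p < q < n\<close>, and once more in the one for \<open>q = n\<close>. The balance
    identity at \<open>Suc p\<close> closes the count.\<close>
  have coeff: "(real n - 1 - real p) * \<alpha> (Suc p) + \<alpha> (Suc p) / h - \<eta> (Suc p) / h + \<beta> (Suc p) = real p + 1"
    if "p < n" for p
  proof -
    have "\<eta> (Suc p) = h * (\<Sum>i<Suc p. \<alpha> i) + r * \<alpha> (Suc p)"
      unfolding \<eta>_def by (induction p) (simp_all add: h_def alpha_0 algebra_simps)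
    then have "\<alpha> (Suc p) / h - \<eta> (Suc p) / h = \<kappa> * \<alpha> (Suc p) - (\<Sum>i<Suc p. \<alpha> i)"
      using h by (simp add: \<kappa>_def divide_simps) (simp add: algebra_simps)
    then show ?thesis
      using balance[of "Suc p"] that by (simp add: \<beta>_def algebra_simps)
  qed
  \<comment> \<open>Expanding \<open>H (Suc p)\<close> makes the products
    \<open>g p \<bullet> H p\<close> telescope, so that only squares survive.\<close>
  have inner_cancel: "h * (\<Sum>q<m. g q \<bullet> H q) + g m \<bullet> H m - (\<Sum>p<m. H (Suc p) \<bullet> (r *\<^sub>R g p + g (Suc p)))
      = - (\<Sum>p<m. r * (r * \<alpha> (Suc p) + \<alpha> p) * G p)" for m
  proof (induction m)
    case (Suc m)
    have "H (Suc m) \<bullet> (r *\<^sub>R g m + g (Suc m))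
      = r * (g m \<bullet> H m) + r * (r * \<alpha> (Suc m) + \<alpha> m) * G m + g (Suc m) \<bullet> H (Suc m)"
      unfolding H_Suc
      by (simp add: G_def inner_add_right inner_add_left inner_commute algebra_simps)
    then show ?case using Suc by (simp add: h_def algebra_simps)
  qed (simp add: H_0)
  \<comment> \<open>The choice of \<open>e\<close> is used here:
    \<open>r\<^sup>2 * e (Suc q)\<close> exceeds \<open>e q\<close> by a constant, so all
    multipliers drop out of the coefficient of \<open>G q\<close>.\<close>
  have diag: "\<alpha> q - r * (r * \<alpha> (Suc q) + \<alpha> q) / h + (\<beta> q - r\<^sup>2 * \<beta> (Suc q)) / (1 - r) = - (1 - r) / 2" for q
  proof -
    have "r\<^sup>2 * e (Suc q) = e q + (1 - r) * h / 2"
      using r by (simp add: e_def h_def field_simps power2_eq_square)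
    moreover have "\<beta> q - r\<^sup>2 * \<beta> (Suc q) = \<kappa> * (e q - \<alpha> q - r\<^sup>2 * e (Suc q) + r\<^sup>2 * \<alpha> (Suc q))"
      by (simp add: \<beta>_def algebra_simps)
    ultimately have "\<beta> q - r\<^sup>2 * \<beta> (Suc q) = \<kappa> * (r\<^sup>2 * \<alpha> (Suc q) - \<alpha> q - (1 - r) * h / 2)"
      by simp
    then have "(\<beta> q - r\<^sup>2 * \<beta> (Suc q)) / (1 - r) = (r\<^sup>2 * \<alpha> (Suc q) - \<alpha> q - (1 - r) * h / 2) / h"
      using r by (simp add: \<kappa>_def)
    then show ?thesis
      using h by (simp add: field_simps power2_eq_square) (simp add: h_def algebra_simps)
  qed
  have last: "\<alpha> n / h = real n * (2 + real n * (1 + r)) / 2"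
  proof -
    have "(1 / r) ^ n = 1 + real n * h"
      using root r by (simp add: h_def field_simps)
    moreover have "(1 / r\<^sup>2) ^ n = ((1 / r) ^ n)\<^sup>2"
      by (simp add: power_divide flip: power_mult) (simp add: mult.commute)
    ultimately have "\<alpha> n = ((1 + real n * h)\<^sup>2 - 1) / 2"
      by (simp add: alpha_n e_def)
    then show ?thesis
      using h unfolding h_def[symmetric] by (simp add: field_simps power2_eq_square)
  qed
  have shift: "(\<Sum>k<n. \<beta> (Suc k) * (G (Suc k) - r\<^sup>2 * G k)) = (\<Sum>k<n. (\<beta> k - r\<^sup>2 * \<beta> (Suc k)) * G k)"
  proof -
    have "\<beta> 0 = 0" "\<beta> n = 0" by (simp_all add: \<beta>_def alpha_0 alpha_n e_def)
    then have "(\<Sum>k<n. \<beta> (Suc k) * G (Suc k) - \<beta> k * G k) = 0"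
      by (simp add: sum_lessThan_telescope[of "\<lambda>k. \<beta> k * G k"])
    then show ?thesis by (simp add: sum_subtractf algebra_simps)
  qed

  have "(\<Sum>j<n. F j - F n) = (\<Sum>p<n. (real p + 1) * \<Delta> p)"
    by (simp add: sum_gaps \<Delta>_def)
  also have "\<dots> = (\<Sum>q<n. \<Sum>p<q. \<alpha> (Suc p) * \<Delta> p) + (\<Sum>p<n. \<alpha> (Suc p) * \<Delta> p) / h
      - (\<Sum>p<n. \<eta> (Suc p) * \<Delta> p) / h + (\<Sum>p<n. \<beta> (Suc p) * \<Delta> p)"
    unfolding sum_tails sum_divide_distrib sum.distrib[symmetric] sum_subtractf[symmetric]
  proof (intro sum.cong refl)
    fix p assume "p \<in> {..<n}"
    then have "(real p + 1) * \<Delta> p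
        = ((real n - 1 - real p) * \<alpha> (Suc p) + \<alpha> (Suc p) / h - \<eta> (Suc p) / h + \<beta> (Suc p)) * \<Delta> p"
      by (simp add: coeff)
    then show "(real p + 1) * \<Delta> p = (real n - 1 - real p) * (\<alpha> (Suc p) * \<Delta> p)
        + \<alpha> (Suc p) * \<Delta> p / h - \<eta> (Suc p) * \<Delta> p / h + \<beta> (Suc p) * \<Delta> p"
      by (simp only: distrib_right left_diff_distrib times_divide_eq_left mult.assoc)
  qed
  \<comment> \<open>The only inequality of the chain: \<open>forward\<close> with weight
    \<open>1\<close> for \<open>q < n\<close> and \<open>1 / h\<close> for \<open>q = n\<close>,
    \<open>backward\<close> with weight \<open>1 / h\<close>, and \<open>adjacent\<close>.\<close>
  also have "\<dots> \<ge> (\<Sum>q<n. g q \<bullet> H q + \<alpha> q * G q) + (g n \<bullet> H n + \<alpha> n * G n) / h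
      - (\<Sum>p<n. H (Suc p) \<bullet> (r *\<^sub>R g p + g (Suc p))) / h
      + (\<Sum>p<n. \<beta> (Suc p) * (G (Suc p) - r\<^sup>2 * G p)) / (1 - r)"
  proof (intro add_mono diff_mono)
    show "(\<Sum>p<n. \<beta> (Suc p) * (G (Suc p) - r\<^sup>2 * G p)) / (1 - r) \<le> (\<Sum>p<n. \<beta> (Suc p) * \<Delta> p)"
      unfolding sum_divide_distrib using adjacent by (intro sum_mono) (simp add: right_diff_distrib)
  qed (use h forward backward in \<open>auto intro!: sum_mono divide_right_mono\<close>)
  also have "(\<Sum>q<n. g q \<bullet> H q + \<alpha> q * G q) + (g n \<bullet> H n + \<alpha> n * G n) / h
      - (\<Sum>p<n. H (Suc p) \<bullet> (r *\<^sub>R g p + g (Suc p))) / h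
      + (\<Sum>p<n. \<beta> (Suc p) * (G (Suc p) - r\<^sup>2 * G p)) / (1 - r)
    = (\<Sum>q<n. \<alpha> q * G q) + \<alpha> n / h * G n + (h * (\<Sum>q<n. g q \<bullet> H q) + g n \<bullet> H n
        - (\<Sum>p<n. H (Suc p) \<bullet> (r *\<^sub>R g p + g (Suc p)))) / h
      + (\<Sum>p<n. \<beta> (Suc p) * (G (Suc p) - r\<^sup>2 * G p)) / (1 - r)"
    using h by (simp add: sum.distrib add_divide_distrib diff_divide_distrib)
  also have "\<dots> = \<alpha> n / h * G n + (\<Sum>q<n. (\<alpha> q - r * (r * \<alpha> (Suc q) + \<alpha> q) / h
      + (\<beta> q - r\<^sup>2 * \<beta> (Suc q)) / (1 - r)) * G q)"
    unfolding inner_cancel shift sum_divide_distrib sum_negf[symmetric]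
    by (simp add: sum.distrib sum_subtractf left_diff_distrib distrib_right diff_divide_distrib sum_negf)
  also have "\<dots> = real n * (2 + real n * (1 + r)) / 2 * G n - (1 - r) / 2 * (\<Sum>q<n. G q)"
    unfolding diag last sum_distrib_left[symmetric] by (simp add: field_simps)
  finally show ?thesis by (simp add: G_def power2_norm_eq_inner)
qed

section \<open>Gradients of smooth convex functions\<close>

text \<open>Riesz representation in the coordinates of \<open>Basis\<close> gives existence, and
  uniqueness of the derivative makes the \<open>THE\<close> in \<open>gradient\<close> well
  defined.\<close>

lemma GDERIV_gradient:
  fixes f :: "'a::euclidean_space \<Rightarrow> real"
  assumes "f differentiable (at x)"
  shows "GDERIV f x :> gradient f x"
proof -
  obtain f' where f': "(f has_derivative f') (at x)"
    using assms by (auto simp: differentiable_def)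
  have "f' v = v \<bullet> (\<Sum>b\<in>Basis. f' b *\<^sub>R b)" for v
  proof -
    have "f' v = f' (\<Sum>b\<in>Basis. (v \<bullet> b) *\<^sub>R b)" by (simp add: euclidean_representation)
    also have "\<dots> = (\<Sum>b\<in>Basis. (v \<bullet> b) * f' b)"
      using has_derivative_linear[OF f'] by (simp add: linear_sum linear_scale)
    finally show ?thesis by (simp add: inner_sum_right mult.commute)
  qed
  then have "f' = (\<lambda>v. v \<bullet> (\<Sum>b\<in>Basis. f' b *\<^sub>R b))" by blast
  then have "GDERIV f x :> (\<Sum>b\<in>Basis. f' b *\<^sub>R b)"
    using f' by (simp add: gderiv_def)
  moreover have "D = D'" if "GDERIV f x :> D" "GDERIV f x :> D'" for D D'
  proof -
    have "(\<lambda>v. v \<bullet> D) = (\<lambda>v. v \<bullet> D')"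
      using that has_derivative_unique unfolding gderiv_def by blast
    then show ?thesis by (metis inner_commute vector_eq_rdot)
  qed
  ultimately show ?thesis
    unfolding gradient_def by (metis (mono_tags, lifting) theI)
qed

lemma L_smooth_line_derivative:
  fixes f :: "'a::euclidean_space \<Rightarrow> real"
  assumes "L_smooth L f"
  shows "((\<lambda>t. f (x + t *\<^sub>R d)) has_real_derivative gradient f (x + t *\<^sub>R d) \<bullet> d) (at t)"
proof -
  have "(f has_derivative (\<lambda>v. v \<bullet> gradient f (x + t *\<^sub>R d))) (at (x + t *\<^sub>R d))"
    using GDERIV_gradient[of f] assms unfolding L_smooth_def gderiv_def by blast
  moreover have "((\<lambda>t. x + t *\<^sub>R d) has_derivative (\<lambda>s. s *\<^sub>R d)) (at t)"
    by (auto intro!: derivative_eq_intros)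
  ultimately have "((\<lambda>t. f (x + t *\<^sub>R d)) has_derivative (\<lambda>s. (s *\<^sub>R d) \<bullet> gradient f (x + t *\<^sub>R d))) (at t)"
    using has_derivative_compose by blast
  then show ?thesis
    by (simp add: has_field_derivative_def inner_commute mult.commute mult_commute_abs)
qed

lemma convex_gradient_below:
  fixes f :: "'a::euclidean_space \<Rightarrow> real"
  assumes conv: "convex_on UNIV f" and smooth: "L_smooth L f"
  shows "f x + gradient f x \<bullet> (z - x) \<le> f z"
proof -
  define \<phi> where "\<phi> = (\<lambda>t. f (x + t *\<^sub>R (z - x)))"
  have "convex_on UNIV \<phi>"
  proof (rule convex_onI)
    fix t a b :: real assume t: "0 < t" "t < 1"
    have "x + ((1 - t) *\<^sub>R a + t *\<^sub>R b) *\<^sub>R (z - x)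
        = (1 - t) *\<^sub>R (x + a *\<^sub>R (z - x)) + t *\<^sub>R (x + b *\<^sub>R (z - x))"
      by (simp add: algebra_simps)
    then show "\<phi> ((1 - t) *\<^sub>R a + t *\<^sub>R b) \<le> (1 - t) * \<phi> a + t * \<phi> b"
      unfolding \<phi>_def using convex_onD[OF conv, of t "x + a *\<^sub>R (z - x)" "x + b *\<^sub>R (z - x)"] t
      by simp
  qed simp
  moreover have "(\<phi> has_real_derivative gradient f x \<bullet> (z - x)) (at 0 within UNIV)"
    using L_smooth_line_derivative[OF smooth, of x "z - x" 0] by (simp add: \<phi>_def)
  ultimately have "gradient f x \<bullet> (z - x) * (1 - 0) \<le> \<phi> 1 - \<phi> 0"
    by (intro convex_on_imp_above_tangent[of UNIV]) auto
  then show ?thesis by (simp add: \<phi>_def)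
qed

lemma descent_lemma:
  fixes f :: "'a::euclidean_space \<Rightarrow> real"
  assumes smooth: "L_smooth L f"
  shows "f z \<le> f x + gradient f x \<bullet> (z - x) + L / 2 * (norm (z - x))\<^sup>2"
proof -
  define d where "d = z - x"
  \<comment> \<open>The Lipschitz bound makes the derivative of \<open>\<psi>\<close> nonpositive on
    the unit interval, which replaces integrating the gradient along the segment.\<close>
  define \<psi> where "\<psi> t = f (x + t *\<^sub>R d) - t * (gradient f x \<bullet> d) - L / 2 * t\<^sup>2 * (norm d)\<^sup>2" for t
  have "\<psi> 1 \<le> \<psi> 0"
  proof (rule DERIV_nonpos_imp_nonincreasing[of 0 1 \<psi>])
    fix t :: real assume t: "0 \<le> t" "t \<le> 1"
    have "(\<psi> has_real_derivative (gradient f (x + t *\<^sub>R d) \<bullet> d - gradient f x \<bullet> d - L * t * (norm d)\<^sup>2)) (at t)"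
      unfolding \<psi>_def
      by (rule derivative_eq_intros L_smooth_line_derivative[OF smooth] refl)+ simp
    moreover have "gradient f (x + t *\<^sub>R d) \<bullet> d - gradient f x \<bullet> d \<le> L * t * (norm d)\<^sup>2"
    proof -
      have "(gradient f (x + t *\<^sub>R d) - gradient f x) \<bullet> d \<le> norm (gradient f (x + t *\<^sub>R d) - gradient f x) * norm d"
        by (rule norm_cauchy_schwarz)
      also have "norm (gradient f (x + t *\<^sub>R d) - gradient f x) \<le> L * norm (t *\<^sub>R d)"
        using smooth lipschitz_on_normD[of L UNIV "gradient f" "x + t *\<^sub>R d" x]
        by (simp add: L_smooth_def)
      finally show ?thesis using t by (simp add: inner_diff_left power2_eq_square mult_ac mult_right_mono)
    qed
    ultimately show "\<exists>y. (\<psi> has_real_derivative y) (at t) \<and> y \<le> 0" by force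
  qed simp
  then show ?thesis by (simp add: \<psi>_def d_def)
qed

text \<open>The point \<open>w\<close> is a gradient step of size \<open>1 / L\<close> from
  \<open>x\<close> for \<open>f\<close> minus its linear part at \<open>z\<close>. There
  \<open>f w\<close> is bounded below by the tangent at \<open>z\<close> and above by the descent
  lemma at \<open>x\<close>.\<close>

lemma smooth_convex_interpolation:
  fixes f :: "'a::euclidean_space \<Rightarrow> real"
  assumes conv: "convex_on UNIV f" and smooth: "L_smooth L f" and L: "L > 0"
  shows "f z + gradient f z \<bullet> (x - z) + (norm (gradient f x - gradient f z))\<^sup>2 / (2 * L) \<le> f x"
proof -
  define D where "D = gradient f x - gradient f z"
  define w where "w = x - (1 / L) *\<^sub>R D"
  have "f z + gradient f z \<bullet> (w - z) \<le> f w"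
    by (rule convex_gradient_below[OF conv smooth])
  also have "\<dots> \<le> f x + gradient f x \<bullet> (w - x) + L / 2 * (norm (w - x))\<^sup>2"
    by (rule descent_lemma[OF smooth])
  finally have "f z + gradient f z \<bullet> (x - z) \<le> f x + D \<bullet> (w - x) + L / 2 * (norm (w - x))\<^sup>2"
    by (simp add: D_def algebra_simps)
  also have "D \<bullet> (w - x) = - (norm D)\<^sup>2 / L"
    by (simp add: w_def power2_norm_eq_inner)
  also have "L / 2 * (norm (w - x))\<^sup>2 = (norm D)\<^sup>2 / (2 * L)"
    using L by (simp add: w_def power_divide power2_eq_square)
  finally show ?thesis using L by (simp add: D_def field_simps)
qed

lemma gradient_at_arg_min:
  fixes f :: "'a::euclidean_space \<Rightarrow> real"
  assumes smooth: "L_smooth L f" and min: "is_arg_min f (\<lambda>_. True) x"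
  shows "gradient f x = 0"
proof -
  have "(f has_derivative (\<lambda>v. v \<bullet> gradient f x)) (at x)"
    using GDERIV_gradient[of f x] smooth unfolding L_smooth_def gderiv_def by blast
  moreover have "\<forall>y\<in>UNIV. f x \<le> f y"
    using min by (simp add: is_arg_min_linorder)
  ultimately have "(\<lambda>v. v \<bullet> gradient f x) = (\<lambda>v. 0)"
    by (intro differential_zero_maxmin[of x UNIV f]) auto
  then show ?thesis by (metis inner_eq_zero_iff)
qed

section \<open>The rate equation, the potential inequality and the three bounds\<close>

lemma rate_equation_unique_root:
  assumes "n \<ge> 1"
  shows "\<exists>!r::real. r \<in> {0<..<1} \<and> r ^ n * (1 + real n * (1 + r)) = 1"
proof -
  define p where "p r = r ^ n * (1 + real n * (1 + r))" for r :: real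
  have less: "p a < p b" if "0 < a" "a < b" for a b
  proof -
    have "a ^ n < b ^ n" using that assms by (intro power_strict_mono) auto
    moreover have "1 + real n * (1 + a) \<le> 1 + real n * (1 + b)" using that by (simp add: mult_left_mono)
    moreover have "1 + real n * (1 + a) > 0" using that by (simp add: add_pos_nonneg)
    ultimately show ?thesis using that unfolding p_def by (intro mult_less_le_imp_less) auto
  qed
  have "p 0 = 0" and "p 1 > 1" using assms by (simp_all add: p_def)
  moreover have "continuous_on {0..1} p" unfolding p_def by (intro continuous_intros)
  ultimately obtain r where r: "0 \<le> r" "r \<le> 1" "p r = 1"
    using IVT'[of p 0 1 1] by auto
  with \<open>p 0 = 0\<close> \<open>p 1 > 1\<close> have "r \<in> {0<..<1}"
    by (metis greaterThanLessThan_iff less_irrefl order_le_less zero_neq_one)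
  then show ?thesis
    using r less unfolding p_def[symmetric]
    by (intro ex1I[of _ r]) (auto, metis less_irrefl linorder_neqE_linordered_idom)
qed

text \<open>Expanding the distances leaves sums of \<open>F j\<close> and of squared gradients over
  all iterates; \<open>last_gradient_bound\<close> trades them for quantities at the last iterate
  alone.\<close>

lemma gradient_descent_potential:
  fixes f :: "'a::euclidean_space \<Rightarrow> real" and x :: "nat \<Rightarrow> 'a"
  assumes conv: "convex_on UNIV f" and smooth: "L_smooth L f" and L: "L > 0"
    and min: "is_arg_min f (\<lambda>_. True) xstar"
    and r: "0 < r" "r < 1" and n: "n \<ge> 1" and root: "r ^ n * (1 + real n * (1 + r)) = 1"
    and h: "h = 1 + r"
    and step: "\<And>i. i < n \<Longrightarrow> x (Suc i) = x i - (h / L) *\<^sub>R gradient f (x i)"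
  shows "(norm (x n - xstar))\<^sup>2 + real n * h * (1 + real n * h) / L\<^sup>2 * (norm (gradient f (x n)))\<^sup>2
    + 2 * real n * h / L * (f (x n) - f xstar) \<le> (norm (x 0 - xstar))\<^sup>2"
proof -
  define g where "g i = (1 / L) *\<^sub>R gradient f (x i)" for i
  define F where "F i = (f (x i) - f xstar) / L - (norm (g i))\<^sup>2 / 2" for i
  define y where "y i = x i - xstar - g i" for i
  have grad: "gradient f (x i) = L *\<^sub>R g i" for i using L by (simp add: g_def)
  have step': "x (Suc i) = x i - h *\<^sub>R g i" if "i < n" for i
    using step[OF that] by (simp add: g_def)
  have subgrad: "F j + g j \<bullet> (y i - y j) \<le> F i" for i j
  proof -
    have "f (x j) + L * (g j \<bullet> (x i - x j)) + L * (norm (g i - g j))\<^sup>2 / 2 \<le> f (x i)"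
      using smooth_convex_interpolation[OF conv smooth L, of "x j" "x i"] L
      unfolding grad by (simp add: scaleR_diff_right[symmetric] power_mult_distrib power2_eq_square mult_ac)
    then have "(f (x j) + L * (g j \<bullet> (x i - x j)) + L * (norm (g i - g j))\<^sup>2 / 2) / L \<le> f (x i) / L"
      using L by (simp add: divide_right_mono)
    then have "f (x j) / L + g j \<bullet> (x i - x j) + (norm (g i - g j))\<^sup>2 / 2 \<le> f (x i) / L"
      using L by (simp add: add_divide_distrib)
    then show ?thesis
      by (simp add: F_def y_def power2_norm_eq_inner inner_diff_left inner_diff_right inner_commute
          diff_divide_distrib add_divide_distrib algebra_simps)
  qed
  \<comment> \<open>The minimizer acts as one more point of the family, with \<open>F\<close>,
    \<open>g\<close> and \<open>y\<close> all zero; this is why \<open>F\<close> and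
    \<open>y\<close> are centred at \<open>xstar\<close>.\<close>
  have star: "F j \<le> g j \<bullet> y j" for j
  proof -
    have "f (x j) + L * (g j \<bullet> (xstar - x j)) + L * (norm (g j))\<^sup>2 / 2 \<le> f xstar"
      using smooth_convex_interpolation[OF conv smooth L, of "x j" xstar] L
      unfolding grad gradient_at_arg_min[OF smooth min] by (simp add: power_mult_distrib power2_eq_square mult_ac)
    then have "(f (x j) + L * (g j \<bullet> (xstar - x j)) + L * (norm (g j))\<^sup>2 / 2) / L \<le> f xstar / L"
      using L by (simp add: divide_right_mono)
    then have "f (x j) / L + g j \<bullet> (xstar - x j) + (norm (g j))\<^sup>2 / 2 \<le> f xstar / L"
      using L by (simp add: add_divide_distrib)
    then show ?thesis
      by (simp add: F_def y_def power2_norm_eq_inner inner_diff_right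
          diff_divide_distrib algebra_simps)
  qed
  \<comment> \<open>The factor \<open>1 - r\<close> is \<open>2 - h\<close>: it collects
    \<open>2 * h\<close> from replacing \<open>x m - xstar\<close> by \<open>y m\<close> and
    \<open>h\<^sup>2\<close> from the squared step.\<close>
  have dist: "(norm (x m - xstar))\<^sup>2 + 2 * h * (\<Sum>j<m. F j) + h * (1 - r) * (\<Sum>j<m. (norm (g j))\<^sup>2)
      \<le> (norm (x 0 - xstar))\<^sup>2" if "m \<le> n" for m
    using that
  proof (induction m)
    case (Suc m)
    have "(norm (x (Suc m) - xstar))\<^sup>2 = (norm (x m - xstar))\<^sup>2 - 2 * h * (g m \<bullet> (x m - xstar)) + h\<^sup>2 * (norm (g m))\<^sup>2"
    proof -
      have "x (Suc m) - xstar = (x m - xstar) - h *\<^sub>R g m" using step'[of m] Suc.prems by simp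
      then show ?thesis
        by (simp only: power2_norm_eq_inner)
          (simp add: inner_diff_left inner_diff_right inner_commute algebra_simps power2_eq_square)
    qed
    moreover have "g m \<bullet> (x m - xstar) = g m \<bullet> y m + (norm (g m))\<^sup>2"
      by (simp add: y_def power2_norm_eq_inner inner_diff_right)
    moreover have "h * F m \<le> h * (g m \<bullet> y m)" using star r h by (intro mult_left_mono) auto
    ultimately have "(norm (x (Suc m) - xstar))\<^sup>2 + 2 * h * F m + h * (1 - r) * (norm (g m))\<^sup>2 \<le> (norm (x m - xstar))\<^sup>2"
      by (simp add: h algebra_simps power2_eq_square)
    then show ?case using Suc by (simp add: algebra_simps)
  qed simp
  have "y i - y (Suc i) = r *\<^sub>R g i + g (Suc i)" if "i < n" for i
    using step'[OF that] by (simp add: y_def h algebra_simps)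
  then have "real n * (2 + real n * h) / 2 * (norm (g n))\<^sup>2
      \<le> (\<Sum>j<n. F j - F n) + (1 - r) / 2 * (\<Sum>j<n. (norm (g j))\<^sup>2)"
    using last_gradient_bound[OF r n root, of F g y] subgrad h by simp
  then have "2 * h * (real n * (2 + real n * h) / 2 * (norm (g n))\<^sup>2 + real n * F n)
      \<le> 2 * h * ((\<Sum>j<n. F j) + (1 - r) / 2 * (\<Sum>j<n. (norm (g j))\<^sup>2))"
    using r h by (intro mult_left_mono) (auto simp: sum_subtractf)
  moreover have "2 * h * ((\<Sum>j<n. F j) + (1 - r) / 2 * (\<Sum>j<n. (norm (g j))\<^sup>2))
      = 2 * h * (\<Sum>j<n. F j) + h * (1 - r) * (\<Sum>j<n. (norm (g j))\<^sup>2)"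
    by (simp add: field_simps)
  ultimately have "(norm (x n - xstar))\<^sup>2 + 2 * h * (real n * (2 + real n * h) / 2 * (norm (g n))\<^sup>2 + real n * F n)
      \<le> (norm (x 0 - xstar))\<^sup>2"
    using dist[of n] by linarith
  \<comment> \<open>The half square inside \<open>F n\<close> lowers the factor
    \<open>2 + n h\<close> to \<open>1 + n h\<close>.\<close>
  moreover have "2 * h * (real n * (2 + real n * h) / 2 * (norm (g n))\<^sup>2 + real n * F n)
      = real n * h * (1 + real n * h) * (norm (g n))\<^sup>2 + 2 * real n * h * ((f (x n) - f xstar) / L)"
    unfolding F_def by (simp add: field_simps)
  moreover have "(norm (gradient f (x n)))\<^sup>2 = L\<^sup>2 * (norm (g n))\<^sup>2"
    unfolding grad by (simp add: power_mult_distrib)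
  ultimately show ?thesis using L by simp
qed

theorem mainTheorem5:
  fixes n :: nat and L :: real and f :: "real ^ 'd \<Rightarrow> real" and xstar :: "real ^ 'd"
  assumes "n \<ge> 1" and "L > 0"
    and "convex_on UNIV f" and "L_smooth L f"
    and "is_arg_min f (\<lambda>_. True) xstar"
  shows "(\<exists>!r::real. r \<in> {0<..<1} \<and> r ^ n * (1 + real n * (1 + r)) = 1) \<and>
    (\<forall>r h \<eta> :: real. r \<in> {0<..<1} \<and> r ^ n * (1 + real n * (1 + r)) = 1 \<and>
        h = 1 + r \<and> \<eta> = r ^ n \<longrightarrow>
      \<eta> = inverse (1 + real n * h) \<and>
      (\<forall>x :: nat \<Rightarrow> real ^ 'd.
        (\<forall>i<n. x (Suc i) = x i - (h / L) *\<^sub>R gradient f (x i)) \<longrightarrow>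
          f (x n) - f xstar \<le> \<eta> * L / (2 * (1 - \<eta>)) * (norm (x 0 - xstar))\<^sup>2 \<and>
          \<eta> * L / (2 * (1 - \<eta>)) * (norm (x 0 - xstar))\<^sup>2
            = L / (2 * real n * h) * (norm (x 0 - xstar))\<^sup>2 \<and>
          (norm (gradient f (x n)))\<^sup>2 \<le> \<eta>\<^sup>2 * L\<^sup>2 / (1 - \<eta>) * (norm (x 0 - xstar))\<^sup>2 \<and>
          \<eta>\<^sup>2 * L\<^sup>2 / (1 - \<eta>) * (norm (x 0 - xstar))\<^sup>2
            = \<eta> * L\<^sup>2 / (real n * h) * (norm (x 0 - xstar))\<^sup>2 \<and>
          norm (x n - xstar) \<le> norm (x 0 - xstar)))"
proof (intro conjI[OF rate_equation_unique_root[OF assms(1)]] allI impI)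
  fix r h \<eta> :: real
  assume A: "r \<in> {0<..<1} \<and> r ^ n * (1 + real n * (1 + r)) = 1 \<and> h = 1 + r \<and> \<eta> = r ^ n"
  define s where "s = real n * h"
  have s: "s > 0" using A assms(1) by (simp add: s_def)
  have "\<eta> * (1 + s) = 1" using A by (simp add: s_def)
  then have eta: "\<eta> = 1 / (1 + s)" using s by (simp add: field_simps)
  have "1 - \<eta> = s / (1 + s)" using s by (simp add: eta field_simps)
  then have rate_f: "\<eta> * L / (2 * (1 - \<eta>)) = L / (2 * s)"
    and rate_g: "\<eta>\<^sup>2 * L\<^sup>2 / (1 - \<eta>) = \<eta> * L\<^sup>2 / s"
    using s by (simp_all add: eta power2_eq_square)
  show "\<eta> = inverse (1 + real n * h) \<and>
      (\<forall>x :: nat \<Rightarrow> real ^ 'd.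
        (\<forall>i<n. x (Suc i) = x i - (h / L) *\<^sub>R gradient f (x i)) \<longrightarrow>
          f (x n) - f xstar \<le> \<eta> * L / (2 * (1 - \<eta>)) * (norm (x 0 - xstar))\<^sup>2 \<and>
          \<eta> * L / (2 * (1 - \<eta>)) * (norm (x 0 - xstar))\<^sup>2
            = L / (2 * real n * h) * (norm (x 0 - xstar))\<^sup>2 \<and>
          (norm (gradient f (x n)))\<^sup>2 \<le> \<eta>\<^sup>2 * L\<^sup>2 / (1 - \<eta>) * (norm (x 0 - xstar))\<^sup>2 \<and>
          \<eta>\<^sup>2 * L\<^sup>2 / (1 - \<eta>) * (norm (x 0 - xstar))\<^sup>2
            = \<eta> * L\<^sup>2 / (real n * h) * (norm (x 0 - xstar))\<^sup>2 \<and>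
          norm (x n - xstar) \<le> norm (x 0 - xstar))"
  proof (intro conjI allI impI)
    show "\<eta> = inverse (1 + real n * h)" by (simp add: eta s_def inverse_eq_divide)
  next
    fix x :: "nat \<Rightarrow> real ^ 'd"
    show "\<eta> * L / (2 * (1 - \<eta>)) * (norm (x 0 - xstar))\<^sup>2 = L / (2 * real n * h) * (norm (x 0 - xstar))\<^sup>2"
      unfolding rate_f by (simp add: s_def mult.assoc)
    show "\<eta>\<^sup>2 * L\<^sup>2 / (1 - \<eta>) * (norm (x 0 - xstar))\<^sup>2 = \<eta> * L\<^sup>2 / (real n * h) * (norm (x 0 - xstar))\<^sup>2"
      unfolding rate_g by (simp add: s_def)
    assume steps: "\<forall>i<n. x (Suc i) = x i - (h / L) *\<^sub>R gradient f (x i)"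
    define R where "R = (norm (x 0 - xstar))\<^sup>2"
    have "(norm (x n - xstar))\<^sup>2 + s * (1 + s) / L\<^sup>2 * (norm (gradient f (x n)))\<^sup>2
        + 2 * s / L * (f (x n) - f xstar) \<le> R"
      using gradient_descent_potential[OF assms(3,4,2,5), of r n h x] A steps assms(1)
      by (simp add: s_def R_def mult.assoc)
    \<comment> \<open>All three terms of the potential are nonnegative, the function gap by
      minimality of \<open>xstar\<close>, so each one alone is at most \<open>R\<close>.\<close>
    moreover have "2 * s / L * (f (x n) - f xstar) \<ge> 0"
      using s assms(2,5) by (simp add: is_arg_min_linorder)
    moreover have "s * (1 + s) / L\<^sup>2 * (norm (gradient f (x n)))\<^sup>2 \<ge> 0"
      using s by simp
    moreover have "(norm (x n - xstar))\<^sup>2 \<ge> 0" by simp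
    ultimately have f_bound: "2 * s / L * (f (x n) - f xstar) \<le> R"
      and g_bound: "s * (1 + s) / L\<^sup>2 * (norm (gradient f (x n)))\<^sup>2 \<le> R"
      and x_bound: "(norm (x n - xstar))\<^sup>2 \<le> R"
      by linarith+
    show "f (x n) - f xstar \<le> \<eta> * L / (2 * (1 - \<eta>)) * (norm (x 0 - xstar))\<^sup>2"
      using f_bound s assms(2) unfolding rate_f R_def[symmetric] by (simp add: field_simps)
    show "(norm (gradient f (x n)))\<^sup>2 \<le> \<eta>\<^sup>2 * L\<^sup>2 / (1 - \<eta>) * (norm (x 0 - xstar))\<^sup>2"
    proof -
      have "(norm (gradient f (x n)))\<^sup>2 * (s * (1 + s)) \<le> R * L\<^sup>2"
        using g_bound assms(2) by (simp add: pos_divide_le_eq mult_ac)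
      then have "(norm (gradient f (x n)))\<^sup>2 \<le> R * L\<^sup>2 / (s * (1 + s))"
        using s by (simp add: pos_le_divide_eq)
      then show ?thesis unfolding rate_g R_def[symmetric] by (simp add: eta mult_ac)
    qed
    show "norm (x n - xstar) \<le> norm (x 0 - xstar)"
      using x_bound unfolding R_def by (rule power2_le_imp_le) simp
  qed
qed

end
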